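(* Let $\{\eta_n\}_{n\in\mathbb{Z}}$ be a sequence of Gaussian real-valued random variables with mean $0$ and variance $\sigma_\eta^2$ (the same for all $n$). Define $\theta_n:=n+\eta_n$ for $n\in\mathbb{Z}$. Then, as $r\to\infty$, $$\frac{\mathbb{E}\left[\operatorname{card}(\{\theta_n : \theta_n\in[-r,r]\})\right]}{2r}=1+O(r^{-1}).$$
   Context: $\operatorname{card}$ denotes the cardinality of a set, and $\mathbb{E}$ denotes expectation. No assumption on the joint law of the $\eta_n$ (such as independence) is made beyond what is stated.
   Formalization: Points are counted by index n (with multiplicity), since with an arbitrary joint law coinciding values make the claim for the cardinality of the set of values false; for that set the claim is proved when the θ_n are pairwise almost surely distinct. *)

theory Defs
  imports "HOL-Probability.Probability" "HOL-Library.Landau_Symbols"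
begin

text \<open>
  The normal law on the real line with mean \<open>m\<close> and variance \<open>s\<^sup>2\<close>. The degenerate case
  \<open>s = 0\<close> is the point mass at \<open>m\<close>; it needs a separate clause because
  \<^term>\<open>normal_density m 0\<close> is identically zero.
\<close>

definition gaussian_law :: "real \<Rightarrow> real \<Rightarrow> real measure" where
  "gaussian_law m s =
     (if s = 0 then return borel m else density lborel (\<lambda>x. ennreal (normal_density m s x)))"

definition gaussian_rv :: "'a measure \<Rightarrow> real \<Rightarrow> real \<Rightarrow> ('a \<Rightarrow> real) \<Rightarrow> bool" where
  "gaussian_rv M m s X \<longleftrightarrow> X \<in> borel_measurable M \<and> distr M borel X = gaussian_law m s"

end

theory Submission
  imports Defs
begin

text \<open>
  By linearity of expectation, the expected number of indices \<open>n\<close> with \<open>\<theta>\<^sub>n \<in> [-r, r]\<close> depends only on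
  the marginal laws. As these all equal one law \<open>\<mu>\<close>, the dependent family can be replaced by the
  shifts \<open>n + x\<close> of a single variable \<open>x\<close> distributed as \<open>\<mu>\<close>. For every \<open>x\<close> the interval
  \<open>[-r - x, r - x]\<close> contains between \<open>2r - 1\<close> and \<open>2r + 1\<close> integers, so the expectation is within
  \<open>1\<close> of \<open>2r\<close>.
\<close>

text \<open>Sectionwise measurability is joint because the index type is countable: the set is a
  countable union of rectangles.\<close>

lemma pred_pair_count_space:
  fixes P :: "'i::countable \<Rightarrow> 'a \<Rightarrow> bool"
  assumes [measurable]: "\<And>i. Measurable.pred M (P i)"
  shows "Measurable.pred (M \<Otimes>\<^sub>M count_space UNIV) (\<lambda>z. P (snd z) (fst z))"
  by (rule measurable_compose_countable[where f = "\<lambda>i z. P i (fst z)"]) measurable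

lemma borel_measurable_emeasure_count_space:
  fixes P :: "'i::countable \<Rightarrow> 'a \<Rightarrow> bool"
  assumes [measurable]: "\<And>i. Measurable.pred M (P i)"
  shows "(\<lambda>\<omega>. emeasure (count_space UNIV) {i. P i \<omega>}) \<in> borel_measurable M"
proof -
  interpret C: sigma_finite_measure "count_space (UNIV :: 'i set)"
    by (rule sigma_finite_measure_count_space)
  note pred_pair_count_space[where M = M and P = P, OF assms, measurable]
  have "(\<lambda>\<omega>. \<integral>\<^sup>+i. indicator {i. P i \<omega>} i \<partial>count_space UNIV) \<in> borel_measurable M"
    by (rule C.borel_measurable_nn_integral) (simp add: split_beta' indicator_def)
  then show ?thesis by simp
qed

text \<open>For infinite \<open>A\<close> both sides take their default value 0, so no finiteness is
  required.\<close>

lemma real_card_eq_enn2real_emeasure: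
  "real (card A) = enn2real (emeasure (count_space UNIV) A)"
  by (cases "finite A") (auto simp: emeasure_count_space_finite emeasure_count_space_infinite
      ennreal_of_nat_eq_real_of_nat)

lemma borel_measurable_card:
  fixes P :: "'i::countable \<Rightarrow> 'a \<Rightarrow> bool"
  assumes "\<And>i. Measurable.pred M (P i)"
  shows "(\<lambda>\<omega>. real (card {i. P i \<omega>})) \<in> borel_measurable M"
  unfolding real_card_eq_enn2real_emeasure
  using borel_measurable_emeasure_count_space[where M = M and P = P] assms by measurable

text \<open>Tonelli for the incidence indicator of \<open>P\<close> on the product of
  \<open>M\<close> with counting measure.\<close>

lemma nn_integral_emeasure_count_space:
  fixes P :: "'i::countable \<Rightarrow> 'a \<Rightarrow> bool"
  assumes "sigma_finite_measure M"
    and [measurable]: "\<And>i. Measurable.pred M (P i)"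
  shows "(\<integral>\<^sup>+\<omega>. emeasure (count_space UNIV) {i. P i \<omega>} \<partial>M) =
    (\<integral>\<^sup>+i. emeasure M {\<omega> \<in> space M. P i \<omega>} \<partial>count_space UNIV)"
proof -
  interpret C: sigma_finite_measure "count_space (UNIV :: 'i set)"
    by (rule sigma_finite_measure_count_space)
  interpret M: sigma_finite_measure M by fact
  interpret pair_sigma_finite M "count_space (UNIV :: 'i set)" ..
  let ?f = "\<lambda>\<omega> i. indicator {i. P i \<omega>} i :: ennreal"
  note pred_pair_count_space[where M = M and P = P, OF assms(2), measurable]
  have "(\<integral>\<^sup>+\<omega>. emeasure (count_space UNIV) {i. P i \<omega>} \<partial>M) =
      (\<integral>\<^sup>+\<omega>. \<integral>\<^sup>+i. ?f \<omega> i \<partial>count_space UNIV \<partial>M)"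
    by simp
  also have "\<dots> = (\<integral>\<^sup>+i. \<integral>\<^sup>+\<omega>. ?f \<omega> i \<partial>M \<partial>count_space UNIV)"
    by (rule Fubini'[symmetric]) (simp add: split_beta' indicator_def)
  also have "\<dots> = (\<integral>\<^sup>+i. \<integral>\<^sup>+\<omega>. indicator {\<omega> \<in> space M. P i \<omega>} \<omega> \<partial>M \<partial>count_space UNIV)"
    by (intro nn_integral_cong) (auto simp: indicator_def)
  finally show ?thesis by simp
qed

text \<open>A finite sum of probabilities makes the index set almost surely finite (first
  Borel-Cantelli). This excludes the outcomes where \<open>card\<close> defaults to 0 although the
  true count is infinite.\<close>

lemma expectation_card_eq:
  fixes P :: "'i::countable \<Rightarrow> 'a \<Rightarrow> bool"
  assumes "sigma_finite_measure M" and P: "\<And>i. Measurable.pred M (P i)"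
    and finite: "(\<integral>\<^sup>+i. emeasure M {\<omega> \<in> space M. P i \<omega>} \<partial>count_space UNIV) < \<infinity>"
  shows "(\<integral>\<omega>. real (card {i. P i \<omega>}) \<partial>M) =
    enn2real (\<integral>\<^sup>+i. emeasure M {\<omega> \<in> space M. P i \<omega>} \<partial>count_space UNIV)"
proof -
  let ?c = "\<lambda>\<omega>. emeasure (count_space UNIV) {i. P i \<omega>}"
  have c: "?c \<in> borel_measurable M" "(\<integral>\<^sup>+\<omega>. ?c \<omega> \<partial>M) < \<infinity>"
    using borel_measurable_emeasure_count_space[where M = M and P = P]
      nn_integral_emeasure_count_space[where M = M and P = P]
      assms by auto
  then have "AE \<omega> in M. ?c \<omega> \<noteq> \<infinity>"
    by (intro nn_integral_PInf_AE) auto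
  then have "AE \<omega> in M. ennreal (real (card {i. P i \<omega>})) = ?c \<omega>"
    by eventually_elim (simp add: real_card_eq_enn2real_emeasure less_top)
  then have "(\<integral>\<^sup>+\<omega>. ennreal (real (card {i. P i \<omega>})) \<partial>M) = (\<integral>\<^sup>+\<omega>. ?c \<omega> \<partial>M)"
    by (rule nn_integral_cong_AE)
  then show ?thesis
    using integral_eq_nn_integral[OF borel_measurable_card[where M = M and P = P, OF P]]
      nn_integral_emeasure_count_space[where M = M and P = P, OF assms(1) P] by simp
qed

lemma card_ints_in_interval:
  fixes a b :: real
  assumes "a \<le> b"
  shows "finite {n::int. a \<le> of_int n \<and> of_int n \<le> b}"
    and "\<bar>real (card {n::int. a \<le> of_int n \<and> of_int n \<le> b}) - (b - a)\<bar> \<le> 1"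
proof -
  have eq: "{n::int. a \<le> of_int n \<and> of_int n \<le> b} = {\<lceil>a\<rceil>..\<lfloor>b\<rfloor>}"
    by (auto simp: le_floor_iff ceiling_le_iff)
  show "finite {n::int. a \<le> of_int n \<and> of_int n \<le> b}"
    by (simp add: eq)
  \<comment> \<open>An interval without integers has
    \<open>\<lceil>a\<rceil> = \<lfloor>b\<rfloor> + 1\<close>, so the cardinality formula is never
    truncated at 0.\<close>
  have "0 \<le> \<lfloor>b\<rfloor> - \<lceil>a\<rceil> + 1"
    using assms by linarith
  then have "real (card {\<lceil>a\<rceil>..\<lfloor>b\<rfloor>}) = of_int (\<lfloor>b\<rfloor> - \<lceil>a\<rceil> + 1)"
    by simp
  then show "\<bar>real (card {n::int. a \<le> of_int n \<and> of_int n \<le> b}) - (b - a)\<bar> \<le> 1"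
    unfolding eq by linarith
qed

lemma expected_card_shifts:
  fixes \<eta> :: "int \<Rightarrow> 'a \<Rightarrow> real"
  assumes "prob_space M"
    and \<eta> [measurable]: "\<And>n. \<eta> n \<in> borel_measurable M"
    and law: "\<And>n. distr M borel (\<eta> n) = \<mu>"
    and r: "0 \<le> r"
  shows "\<bar>(\<integral>\<omega>. real (card {n. of_int n + \<eta> n \<omega> \<in> {-r..r}}) \<partial>M) - 2 * r\<bar> \<le> 1"
proof -
  interpret M: prob_space M by fact
  interpret \<mu>: prob_space \<mu>
    using M.prob_space_distr[OF \<eta>, of 0] by (simp add: law)
  have sets [measurable_cong]: "sets \<mu> = sets borel"
    using law[of 0] by (metis sets_distr)
  let ?N = "\<lambda>x. {n::int. of_int n + x \<in> {-r..r}}"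
  have N: "?N x = {n. - r - x \<le> of_int n \<and> of_int n \<le> r - x}" for x :: real
    by auto
  have fin: "finite (?N x)" and card: "\<bar>real (card (?N x)) - 2 * r\<bar> \<le> 1" for x :: real
    using card_ints_in_interval[of "- r - x" "r - x"] r unfolding N by auto
  have marginal: "emeasure M {\<omega> \<in> space M. of_int n + \<eta> n \<omega> \<in> {-r..r}} =
      emeasure \<mu> {x \<in> space \<mu>. of_int n + x \<in> {-r..r}}" for n :: int
    by (subst (1 2) law[of n, symmetric], subst emeasure_distr)
      (auto intro!: arg_cong[where f = "emeasure M"])
  \<comment> \<open>Finiteness is proved on the side of \<mu>, where the count is bounded pointwise
    by \<open>2 * r + 1\<close>; for the family \<open>\<eta>\<close> no pointwise bound is
    available.\<close>
  have "(\<integral>\<^sup>+n. emeasure \<mu> {x \<in> space \<mu>. of_int n + x \<in> {-r..r}} \<partial>count_space UNIV) =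
      (\<integral>\<^sup>+x. emeasure (count_space UNIV) (?N x) \<partial>\<mu>)"
    by (rule nn_integral_emeasure_count_space[symmetric]) (unfold_locales, measurable)
  also have "\<dots> \<le> (\<integral>\<^sup>+x. ennreal (2 * r + 1) \<partial>\<mu>)"
  proof (rule nn_integral_mono)
    fix x
    have "real (card (?N x)) \<le> 2 * r + 1"
      using card[of x] by linarith
    then show "emeasure (count_space UNIV) (?N x) \<le> ennreal (2 * r + 1)"
      using fin[of x] by (simp add: emeasure_count_space_finite ennreal_of_nat_eq_real_of_nat ennreal_leI
          del: ennreal_plus)
  qed
  also have "\<dots> < \<infinity>"
    by (simp add: \<mu>.emeasure_space_1)
  finally have finite:
    "(\<integral>\<^sup>+n. emeasure \<mu> {x \<in> space \<mu>. of_int n + x \<in> {-r..r}} \<partial>count_space (UNIV :: int set)) < \<infinity>" .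
  \<comment> \<open>Tonelli is used once on \<open>M\<close> and once backwards on \<mu>; the sums
    of marginal probabilities in between agree term by term.\<close>
  have "(\<integral>\<omega>. real (card {n. of_int n + \<eta> n \<omega> \<in> {-r..r}}) \<partial>M) =
      enn2real (\<integral>\<^sup>+n. emeasure M {\<omega> \<in> space M. of_int n + \<eta> n \<omega> \<in> {-r..r}} \<partial>count_space UNIV)"
    using finite by (intro expectation_card_eq M.sigma_finite_measure_axioms)
      (measurable, simp only: marginal)
  also have "\<dots> = (\<integral>x. real (card (?N x)) \<partial>\<mu>)"
    unfolding marginal using finite
    by (intro expectation_card_eq[symmetric] \<mu>.sigma_finite_measure_axioms) measurable
  finally have eq: "(\<integral>\<omega>. real (card {n. of_int n + \<eta> n \<omega> \<in> {-r..r}}) \<partial>M) =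
      (\<integral>x. real (card (?N x)) \<partial>\<mu>)" .
  have bounds: "2 * r - 1 \<le> real (card (?N x))" "real (card (?N x)) \<le> 2 * r + 1" for x :: real
    using card[of x] by linarith+
  have "(\<lambda>x. real (card (?N x))) \<in> borel_measurable \<mu>"
    by (rule borel_measurable_card) measurable
  then have "integrable \<mu> (\<lambda>x. real (card (?N x)))"
    using bounds by (intro \<mu>.integrable_const_bound[where B = "2 * r + 1"]) auto
  then have "2 * r - 1 \<le> (\<integral>x. real (card (?N x)) \<partial>\<mu>)" "(\<integral>x. real (card (?N x)) \<partial>\<mu>) \<le> 2 * r + 1"
    using bounds by (auto intro!: \<mu>.integral_ge_const \<mu>.integral_le_const)
  then show ?thesis
    unfolding eq by linarith
qed

text \<open>
  Measurability of the number of distinct values needs an argument: each value is counted at its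
  first index with respect to an enumeration of the index type.
\<close>

lemma borel_measurable_card_values:
  fixes \<theta> :: "'i::countable \<Rightarrow> 'a \<Rightarrow> real"
  assumes [measurable]: "\<And>n. \<theta> n \<in> borel_measurable M" "S \<in> sets borel"
  shows "(\<lambda>\<omega>. real (card {\<theta> n \<omega> |n. \<theta> n \<omega> \<in> S})) \<in> borel_measurable M"
proof -
  \<comment> \<open>Minimality may range over all \<open>m\<close>, since an index with the same
    value also has its value in \<open>S\<close>.\<close>
  let ?P = "\<lambda>n \<omega>. \<theta> n \<omega> \<in> S \<and> (\<forall>m. to_nat m < to_nat n \<longrightarrow> \<theta> m \<omega> \<noteq> \<theta> n \<omega>)"
  have "card {\<theta> n \<omega> |n. \<theta> n \<omega> \<in> S} = card {n. ?P n \<omega>}" for \<omega>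
  proof -
    have "\<exists>k. ?P k \<omega> \<and> \<theta> k \<omega> = \<theta> n \<omega>" if "\<theta> n \<omega> \<in> S" for n
    proof -
      let ?k = "arg_min to_nat (\<lambda>m. \<theta> m \<omega> = \<theta> n \<omega>)"
      have k: "\<theta> ?k \<omega> = \<theta> n \<omega>"
        by (rule arg_min_natI) simp
      have "\<theta> m \<omega> \<noteq> \<theta> ?k \<omega>" if "to_nat m < to_nat ?k" for m
        using that arg_min_nat_le[of "\<lambda>m. \<theta> m \<omega> = \<theta> n \<omega>" m to_nat] k by (metis not_less)
      with k that show ?thesis
        by metis
    qed
    then have "{\<theta> n \<omega> |n. \<theta> n \<omega> \<in> S} = (\<lambda>n. \<theta> n \<omega>) ` {n. ?P n \<omega>}"
      by (auto simp: image_iff) metis+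
    moreover have "inj_on (\<lambda>n. \<theta> n \<omega>) {n. ?P n \<omega>}"
    proof (rule inj_onI)
      fix m n
      assume "m \<in> {n. ?P n \<omega>}" "n \<in> {n. ?P n \<omega>}" "\<theta> m \<omega> = \<theta> n \<omega>"
      then have "\<not> to_nat m < to_nat n" "\<not> to_nat n < to_nat m"
        by auto
      then show "m = n"
        by (metis linorder_neqE_nat to_nat_split inj_to_nat injD)
    qed
    \<comment> \<open>An injective image preserves \<open>card\<close> even for infinite sets, where
      both sides are 0.\<close>
    ultimately show ?thesis
      by (simp only: card_image)
  qed
  moreover have "(\<lambda>\<omega>. real (card {n. ?P n \<omega>})) \<in> borel_measurable M"
    by (rule borel_measurable_card) measurable
  ultimately show ?thesis
    by simp
qed

text \<open>There are only countably many pairs of indices, so the exceptional null sets have a null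
  union. Off it \<open>n \<mapsto> \<theta> n \<omega>\<close> is injective, and counting values is
  counting indices.\<close>

lemma expectation_card_values_eq:
  fixes \<theta> :: "'i::countable \<Rightarrow> 'a \<Rightarrow> real"
  assumes [measurable]: "\<And>n. \<theta> n \<in> borel_measurable M" "S \<in> sets borel"
    and distinct: "\<And>m n. m \<noteq> n \<Longrightarrow> AE \<omega> in M. \<theta> m \<omega> \<noteq> \<theta> n \<omega>"
  shows "(\<integral>\<omega>. real (card {\<theta> n \<omega> |n. \<theta> n \<omega> \<in> S}) \<partial>M) =
    (\<integral>\<omega>. real (card {n. \<theta> n \<omega> \<in> S}) \<partial>M)"
proof (rule integral_cong_AE)
  have "AE \<omega> in M. \<forall>m n. m \<noteq> n \<longrightarrow> \<theta> m \<omega> \<noteq> \<theta> n \<omega>"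
    unfolding AE_all_countable using distinct by auto
  then show "AE \<omega> in M. real (card {\<theta> n \<omega> |n. \<theta> n \<omega> \<in> S}) = real (card {n. \<theta> n \<omega> \<in> S})"
  proof eventually_elim
    case (elim \<omega>)
    then have "inj_on (\<lambda>n. \<theta> n \<omega>) {n. \<theta> n \<omega> \<in> S}"
      by (meson inj_onI)
    moreover have "{\<theta> n \<omega> |n. \<theta> n \<omega> \<in> S} = (\<lambda>n. \<theta> n \<omega>) ` {n. \<theta> n \<omega> \<in> S}"
      by auto
    ultimately show ?case
      by (simp only: card_image)
  qed
  show "(\<lambda>\<omega>. real (card {\<theta> n \<omega> |n. \<theta> n \<omega> \<in> S})) \<in> borel_measurable M"
    by (rule borel_measurable_card_values) measurable
  show "(\<lambda>\<omega>. real (card {n. \<theta> n \<omega> \<in> S})) \<in> borel_measurable M"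
    by (rule borel_measurable_card) measurable
qed

text \<open>The first conjunct counts points with multiplicity, the second counts distinct values.
  The joint law is arbitrary, so for \<sigma> > 0 each pair of points \<open>2k\<close>,
  \<open>2k+1\<close> can be coupled to coincide with a fixed positive probability. The set of
  values then loses a positive fraction of its expected size, which is why the second count is
  stated under almost sure distinctness.\<close>

theorem lemma2p1:
  fixes M :: "'a measure" and \<eta> \<theta> :: "int \<Rightarrow> 'a \<Rightarrow> real" and \<sigma> :: real
  assumes "prob_space M"
    and "\<sigma> \<ge> 0"
    and "\<And>n. gaussian_rv M 0 \<sigma> (\<eta> n)"
    and "\<And>n \<omega>. \<theta> n \<omega> = of_int n + \<eta> n \<omega>"
  shows "(\<lambda>r::real. prob_space.expectation M
             (\<lambda>\<omega>. real (card {n. \<theta> n \<omega> \<in> {-r..r}})) / (2 * r) - 1) \<in> O(\<lambda>r. 1 / r)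
       \<and> ((\<forall>m n. m \<noteq> n \<longrightarrow> (AE \<omega> in M. \<theta> m \<omega> \<noteq> \<theta> n \<omega>)) \<longrightarrow>
           (\<lambda>r::real. prob_space.expectation M
             (\<lambda>\<omega>. real (card {\<theta> n \<omega> |n. \<theta> n \<omega> \<in> {-r..r}})) / (2 * r) - 1) \<in> O(\<lambda>r. 1 / r))"
proof -
  have meas: "\<eta> n \<in> borel_measurable M" and law: "distr M borel (\<eta> n) = gaussian_law 0 \<sigma>" for n
    using assms(3) by (auto simp: gaussian_rv_def)
  have \<theta>: "\<theta> n = (\<lambda>\<omega>. of_int n + \<eta> n \<omega>)" for n
    using assms(4) by auto
  have meas_\<theta>: "\<theta> n \<in> borel_measurable M" for n
    unfolding \<theta> using meas by measurable
  let ?E = "\<lambda>r::real. prob_space.expectation M (\<lambda>\<omega>. real (card {n. \<theta> n \<omega> \<in> {-r..r}}))"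
  \<comment> \<open>Dividing the error 1 by \<open>2 * r\<close> gives at most
    \<open>1 / (2 * r)\<close>, so the constant 1 suffices.\<close>
  have "norm (?E r / (2 * r) - 1) \<le> 1 * norm (1 / r)" if "0 < r" for r
  proof -
    have "\<bar>?E r - 2 * r\<bar> \<le> 1"
      using expected_card_shifts[OF assms(1) meas law, of r] that by (simp add: \<theta>)
    moreover have "?E r / (2 * r) - 1 = (?E r - 2 * r) / (2 * r)"
      using that by (simp add: field_simps)
    ultimately show ?thesis
      using that by (simp add: abs_divide divide_le_eq)
  qed
  then have count: "(\<lambda>r. ?E r / (2 * r) - 1) \<in> O(\<lambda>r. 1 / r)"
    by (intro bigoI[where c = 1] eventually_mono[OF eventually_gt_at_top[of 0]])
  \<comment> \<open>The two expectations agree for every \<open>r\<close>, so the second asymptotic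
    is the first one rewritten.\<close>
  have "prob_space.expectation M (\<lambda>\<omega>. real (card {\<theta> n \<omega> |n. \<theta> n \<omega> \<in> {-r..r}})) = ?E r"
    if "\<forall>m n. m \<noteq> n \<longrightarrow> (AE \<omega> in M. \<theta> m \<omega> \<noteq> \<theta> n \<omega>)" for r
    using that meas_\<theta> by (intro expectation_card_values_eq) auto
  with count show ?thesis
    by simp
qed

end
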